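(* Let $I \subset \mathbb{R}$ be a real interval, let $\le$ be the restriction of the usual order of $\mathbb{R}$ to $I$, and let $\circ : I^2 \to I$ be a binary operation such that $(I, \le, \circ)$ is a strictly linearly ordered semigroup. Suppose that every element of $I$ admits a square root. Then $(I, \le, \circ)$ is isomorphic to the strictly linearly ordered semigroup $(J, \le, +)$, where $J$ is one of the real intervals $\mathbb{R}$, $[0,\infty)$, $(0,\infty)$ or $\{0\}$, and $\le$ and $+$ are the usual order and addition of real numbers.
   Context: A strictly linearly ordered semigroup is a tuple $(X, \le, \circ)$, where $X$ is a non-empty set, $\le$ is a linear order on $X$, and $\circ : X^2 \to X$ is an associative map such that $a < b$ implies $a \circ x < b \circ x$ and $x \circ a < x \circ b$ for all $a, b, x \in X$ (where $a<b$ means $a \le b$ and $a \ne b$). Here a real interval is any non-empty interval of $\mathbb{R}$ (open, closed, half-open, bounded or unbounded, possibly a single point). An element $x$ of a strictly linearly ordered semigroup admits a square root if there is an element $y$ of the semigroup such that $y \circ y = x$. An isomorphism of two strictly linearly ordered semigroups $(X, \le, \circ)$ and $(Y, \le, \diamond)$ is a function $f : X \to Y$ which is monotone (either increasing or decreasing; order-reversing maps are allowed), bijective, and satisfies $f(x_1 \circ x_2) = f(x_1) \diamond f(x_2)$ for all $x_1, x_2 \in X$. Two such semigroups are isomorphic if there exists an isomorphism between them. *)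

theory Defs
  imports "HOL-Analysis.Analysis"
begin

text \<open>The order and the operation are given on the whole type, but only their restrictions to the
  carrier \<open>X\<close> matter; \<open>closed\<close> says that the operation restricts to a map \<open>X \<times> X \<rightarrow> X\<close>.\<close>

locale strictly_linearly_ordered_semigroup =
  fixes X :: "'a set"
    and le :: "'a \<Rightarrow> 'a \<Rightarrow> bool" (infix \<open>\<preceq>\<close> 50)
    and mul :: "'a \<Rightarrow> 'a \<Rightarrow> 'a" (infixl \<open>\<odot>\<close> 70)
  assumes nonempty: "X \<noteq> {}"
    and reflexive: "reflp_on X (\<preceq>)"
    and transitive: "transp_on X (\<preceq>)"
    and antisymmetric: "antisymp_on X (\<preceq>)"
    and total: "totalp_on X (\<preceq>)"
    and closed: "a \<in> X \<Longrightarrow> b \<in> X \<Longrightarrow> a \<odot> b \<in> X"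
    and assoc: "a \<in> X \<Longrightarrow> b \<in> X \<Longrightarrow> c \<in> X \<Longrightarrow> (a \<odot> b) \<odot> c = a \<odot> (b \<odot> c)"
    and strict_right: "a \<in> X \<Longrightarrow> b \<in> X \<Longrightarrow> x \<in> X \<Longrightarrow> a \<preceq> b \<Longrightarrow> a \<noteq> b \<Longrightarrow>
      a \<odot> x \<preceq> b \<odot> x \<and> a \<odot> x \<noteq> b \<odot> x"
    and strict_left: "a \<in> X \<Longrightarrow> b \<in> X \<Longrightarrow> x \<in> X \<Longrightarrow> a \<preceq> b \<Longrightarrow> a \<noteq> b \<Longrightarrow>
      x \<odot> a \<preceq> x \<odot> b \<and> x \<odot> a \<noteq> x \<odot> b"

definition admits_square_root :: "'a set \<Rightarrow> ('a \<Rightarrow> 'a \<Rightarrow> 'a) \<Rightarrow> 'a \<Rightarrow> bool" where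
  "admits_square_root X mul x \<longleftrightarrow> (\<exists>y\<in>X. mul y y = x)"

text \<open>Order-reversing isomorphisms are allowed.\<close>

definition slos_isomorphism ::
  "('a \<Rightarrow> 'b) \<Rightarrow> 'a set \<Rightarrow> ('a \<Rightarrow> 'a \<Rightarrow> bool) \<Rightarrow> ('a \<Rightarrow> 'a \<Rightarrow> 'a) \<Rightarrow>
    'b set \<Rightarrow> ('b \<Rightarrow> 'b \<Rightarrow> bool) \<Rightarrow> ('b \<Rightarrow> 'b \<Rightarrow> 'b) \<Rightarrow> bool" where
  "slos_isomorphism f X leX mulX Y leY mulY \<longleftrightarrow>
     strictly_linearly_ordered_semigroup X leX mulX \<and>
     strictly_linearly_ordered_semigroup Y leY mulY \<and>
     (monotone_on X leX leY f \<or> monotone_on X leX (\<lambda>u v. leY v u) f) \<and>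
     bij_betw f X Y \<and>
     (\<forall>x\<^sub>1\<in>X. \<forall>x\<^sub>2\<in>X. f (mulX x\<^sub>1 x\<^sub>2) = mulY (f x\<^sub>1) (f x\<^sub>2))"

definition slos_isomorphic ::
  "'a set \<Rightarrow> ('a \<Rightarrow> 'a \<Rightarrow> bool) \<Rightarrow> ('a \<Rightarrow> 'a \<Rightarrow> 'a) \<Rightarrow>
    'b set \<Rightarrow> ('b \<Rightarrow> 'b \<Rightarrow> bool) \<Rightarrow> ('b \<Rightarrow> 'b \<Rightarrow> 'b) \<Rightarrow> bool" where
  "slos_isomorphic X leX mulX Y leY mulY \<longleftrightarrow>
     (\<exists>f. slos_isomorphism f X leX mulX Y leY mulY)"

end

theory Submission
  imports Defs
begin

text \<open>Squaring is an order automorphism of \<open>I\<close>, so the supremum of a bounded set of powers \<open>a\<^sup>n\<close>, and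
  likewise the infimum of iterated square roots, would be idempotent. If every element is positive
  (\<open>x < x \<odot> x\<close>), this makes the semigroup Archimedean with arbitrarily small elements, and Hoelder's
  argument yields an additive, monotone and surjective map onto \<open>(0, \<infinity>)\<close>. It is injective because \<open>\<real>\<close> does
  not contain uncountably many disjoint open intervals. In general, either every element becomes
  positive after multiplication by a suitable positive one, and the map extends from the positive
  part to all of \<open>I\<close>, or this holds in the semigroup with the order reversed.\<close>

section \<open>Cancellation, idempotents and powers\<close>

locale rooted_interval_semigroup = strictly_linearly_ordered_semigroup I "(\<le>)" mul
  for I :: "real set" and mul :: "real \<Rightarrow> real \<Rightarrow> real" (infixl \<open>\<odot>\<close> 70) +
  assumes interval: "is_interval I"
    and roots: "x \<in> I \<Longrightarrow> admits_square_root I (\<odot>) x"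
begin

lemma mul_less_right: "a \<in> I \<Longrightarrow> b \<in> I \<Longrightarrow> x \<in> I \<Longrightarrow> a < b \<Longrightarrow> a \<odot> x < b \<odot> x"
  using strict_right[of a b x] by force

lemma mul_less_left: "a \<in> I \<Longrightarrow> b \<in> I \<Longrightarrow> x \<in> I \<Longrightarrow> a < b \<Longrightarrow> x \<odot> a < x \<odot> b"
  using strict_left[of a b x] by force

lemma mul_less_iff_right [simp]:
  "a \<in> I \<Longrightarrow> b \<in> I \<Longrightarrow> x \<in> I \<Longrightarrow> a \<odot> x < b \<odot> x \<longleftrightarrow> a < b"
  using mul_less_right[of a b x] mul_less_right[of b a x] by (cases a b rule: linorder_cases) auto

lemma mul_less_iff_left [simp]:
  "a \<in> I \<Longrightarrow> b \<in> I \<Longrightarrow> x \<in> I \<Longrightarrow> x \<odot> a < x \<odot> b \<longleftrightarrow> a < b"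
  using mul_less_left[of a b x] mul_less_left[of b a x] by (cases a b rule: linorder_cases) auto

lemma mul_eq_iff_right [simp]:
  "a \<in> I \<Longrightarrow> b \<in> I \<Longrightarrow> x \<in> I \<Longrightarrow> a \<odot> x = b \<odot> x \<longleftrightarrow> a = b"
  by (metis less_irrefl linorder_neqE mul_less_right)

lemma mul_eq_iff_left [simp]:
  "a \<in> I \<Longrightarrow> b \<in> I \<Longrightarrow> x \<in> I \<Longrightarrow> x \<odot> a = x \<odot> b \<longleftrightarrow> a = b"
  by (metis less_irrefl linorder_neqE mul_less_left)

lemma mul_less_mono:
  "a \<in> I \<Longrightarrow> b \<in> I \<Longrightarrow> c \<in> I \<Longrightarrow> d \<in> I \<Longrightarrow> a < b \<Longrightarrow> c < d \<Longrightarrow> a \<odot> c < b \<odot> d"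
  using mul_less_right[of a b c] mul_less_left[of c d b] by linarith

lemma mul_le_mono:
  "a \<in> I \<Longrightarrow> b \<in> I \<Longrightarrow> c \<in> I \<Longrightarrow> d \<in> I \<Longrightarrow> a \<le> b \<Longrightarrow> c \<le> d \<Longrightarrow> a \<odot> c \<le> b \<odot> d"
  using mul_less_right[of a b c] mul_less_left[of c d b] by (smt (verit))

lemma square_less_iff: "a \<in> I \<Longrightarrow> b \<in> I \<Longrightarrow> a \<odot> a < b \<odot> b \<longleftrightarrow> a < b"
  using mul_less_mono[of a b a b] mul_le_mono[of b a b a] by force

text \<open>Multiplying the first comparison by \<open>x\<close> on the left and the second by
  \<open>y\<close> on the right gives the same comparison. So a single
  \<open>x < x \<odot> x\<close> makes left multiplication by \<open>x\<close> move every element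
  up.\<close>

lemma less_mul_left_iff: "x \<in> I \<Longrightarrow> y \<in> I \<Longrightarrow> y < x \<odot> y \<longleftrightarrow> x < x \<odot> x"
  using mul_less_iff_left[of y "x \<odot> y" x] mul_less_iff_right[of x "x \<odot> x" y]
  by (simp add: closed assoc)

lemma less_mul_right_iff: "x \<in> I \<Longrightarrow> y \<in> I \<Longrightarrow> x < x \<odot> y \<longleftrightarrow> y < y \<odot> y"
  using mul_less_iff_right[of x "x \<odot> y" y] mul_less_iff_left[of y "y \<odot> y" x]
  by (simp add: closed assoc)

lemma mul_left_eq_iff: "x \<in> I \<Longrightarrow> y \<in> I \<Longrightarrow> x \<odot> y = y \<longleftrightarrow> x \<odot> x = x"
  using mul_eq_iff_left[of "x \<odot> y" y x] mul_eq_iff_right[of "x \<odot> x" x y]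
  by (simp add: closed assoc)

lemma mul_right_eq_iff: "x \<in> I \<Longrightarrow> y \<in> I \<Longrightarrow> x \<odot> y = x \<longleftrightarrow> y \<odot> y = y"
  using mul_eq_iff_right[of "x \<odot> y" x y] mul_eq_iff_left[of "y \<odot> y" y x]
  by (simp add: closed assoc)

definition sqroot :: "real \<Rightarrow> real" where
  "sqroot x = (SOME y. y \<in> I \<and> y \<odot> y = x)"

lemma sqroot: 
  assumes "x \<in> I" 
  shows sqroot_in: "sqroot x \<in> I" and sqroot_square: "sqroot x \<odot> sqroot x = x"
proof -
  have "sqroot x \<in> I \<and> sqroot x \<odot> sqroot x = x"
    unfolding sqroot_def by (rule someI_ex) (use roots[OF assms] in \<open>auto simp: admits_square_root_def\<close>)
  then show "sqroot x \<in> I" "sqroot x \<odot> sqroot x = x" by auto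
qed

text \<open>Puts suprema and infima that are squeezed between two elements into
  \<open>I\<close>.\<close>

lemma between_in: "a \<in> I \<Longrightarrow> b \<in> I \<Longrightarrow> a \<le> x \<Longrightarrow> x \<le> b \<Longrightarrow> x \<in> I"
  using interval mem_is_interval_1_I by blast

text \<open>The exponent is shifted by one, \<open>power_Suc x 0\<close> being the first power,
  because \<open>I\<close> need not have a neutral element.\<close>

primrec power_Suc :: "real \<Rightarrow> nat \<Rightarrow> real" where
  "power_Suc x 0 = x"
| "power_Suc x (Suc n) = power_Suc x n \<odot> x"

lemma power_Suc_in [simp]: "x \<in> I \<Longrightarrow> power_Suc x n \<in> I"
  by (induction n) (auto intro: closed)

lemma power_Suc_add:
  "x \<in> I \<Longrightarrow> power_Suc x m \<odot> power_Suc x n = power_Suc x (Suc (m + n))"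
  by (induction n) (auto simp: assoc[symmetric])

end

section \<open>The positive case: Archimedean property, small elements, dyadic multiples\<close>

locale positive_interval_semigroup = rooted_interval_semigroup +
  assumes less_square: "x \<in> I \<Longrightarrow> x < x \<odot> x"
begin

lemma less_mul_right: "x \<in> I \<Longrightarrow> y \<in> I \<Longrightarrow> x < x \<odot> y"
  using less_mul_right_iff less_square by blast

lemma strict_mono_power_Suc: "x \<in> I \<Longrightarrow> strict_mono (power_Suc x)"
  by (rule strict_monoI_Suc) (simp add: less_mul_right)

text \<open>If all powers stayed below \<open>b\<close>, their supremum \<open>s\<close> would lie
  in \<open>I\<close>. The root of \<open>s\<close> is smaller than \<open>s\<close>, hence below
  some power; squaring gives a power beyond \<open>s\<close>.\<close>

lemma archimedean:
  assumes a: "a \<in> I" and b: "b \<in> I"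
  shows "\<exists>n. b < power_Suc a n"
proof (rule ccontr)
  assume "\<not> ?thesis"
  then have le: "power_Suc a n \<le> b" for n by (simp add: not_less)
  define s where "s = (SUP n. power_Suc a n)"
  have bdd: "bdd_above (range (power_Suc a))" using le by (rule bdd_aboveI2)
  have ub: "power_Suc a n \<le> s" for n
    unfolding s_def by (rule cSUP_upper[OF _ bdd]) auto
  have "s \<le> b" unfolding s_def by (rule cSUP_least) (use le in auto)
  then have s: "s \<in> I" using between_in[OF a b] ub[of 0] by simp
  define r where "r = sqroot s"
  have r: "r \<in> I" "r \<odot> r = s" using sqroot[OF s] by (auto simp: r_def)
  then have "r < s" using less_square by force
  then obtain n where "r < power_Suc a n"
    unfolding s_def using less_cSUP_iff[OF _ bdd] by auto
  then have "r \<odot> r < power_Suc a n \<odot> power_Suc a n"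
    using a r by (intro mul_less_mono) auto
  also have "\<dots> \<le> s" using ub a by (simp only: power_Suc_add)
  finally show False using r by simp
qed

text \<open>An arbitrary unit of measurement: it will receive the magnitude 1.\<close>

definition base :: real where "base = (SOME x. x \<in> I)"

definition dyadic_root :: "nat \<Rightarrow> real" where "dyadic_root n = (sqroot ^^ n) base"

lemma dyadic_root_in [simp]: "dyadic_root n \<in> I"
proof (induction n)
  case 0
  then show ?case using nonempty unfolding dyadic_root_def base_def by (simp add: some_in_eq)
qed (simp add: dyadic_root_def sqroot_in)

lemma dyadic_root_Suc: "dyadic_root (Suc n) \<odot> dyadic_root (Suc n) = dyadic_root n"
  using dyadic_root_in[of n] by (simp add: dyadic_root_def sqroot_square)

lemma decseq_dyadic_root: "decseq dyadic_root"
  by (rule decseq_SucI) (use less_square[OF dyadic_root_in] in \<open>metis dyadic_root_Suc less_imp_le\<close>)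

text \<open>Otherwise the infimum \<open>t\<close> of the roots lies in \<open>I\<close>. As
  \<open>t < t \<odot> t\<close>, some root drops below \<open>t \<odot> t\<close>, and then the
  next root drops below \<open>t\<close>.\<close>

lemma dyadic_root_small:
  assumes x: "x \<in> I"
  shows "\<exists>n. dyadic_root n < x"
proof (rule ccontr)
  assume "\<not> ?thesis"
  then have le: "x \<le> dyadic_root n" for n by (simp add: not_less)
  define t where "t = (INF n. dyadic_root n)"
  have bdd: "bdd_below (range dyadic_root)" using le by (rule bdd_belowI2)
  have lb: "t \<le> dyadic_root n" for n
    unfolding t_def by (rule cINF_lower[OF bdd]) auto
  have "x \<le> t" unfolding t_def by (rule cINF_greatest) (use le in auto)
  then have t: "t \<in> I" using between_in[OF x dyadic_root_in[of 0]] lb by simp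
  have "t < t \<odot> t" using less_square t by simp
  then obtain n where "dyadic_root n < t \<odot> t"
    unfolding t_def using cINF_less_iff[OF _ bdd] by auto
  then have "dyadic_root (Suc n) < t"
    using t by (simp add: dyadic_root_Suc[of n, symmetric] square_less_iff)
  then show False using lb[of "Suc n"] by simp
qed

text \<open>The element that receives the value \<open>k / 2 ^ n\<close>; meaningful for \<open>k > 0\<close> only.\<close>

definition dyadic :: "nat \<Rightarrow> nat \<Rightarrow> real" where "dyadic n k = power_Suc (dyadic_root n) (k - 1)"

lemma dyadic_in [simp]: "dyadic n k \<in> I"
  by (simp add: dyadic_def)

lemma dyadic_add: "k > 0 \<Longrightarrow> l > 0 \<Longrightarrow> dyadic n k \<odot> dyadic n l = dyadic n (k + l)"
  by (cases k; cases l) (simp_all add: dyadic_def power_Suc_add del: power_Suc.simps)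

lemma dyadic_less_iff: "k > 0 \<Longrightarrow> l > 0 \<Longrightarrow> dyadic n k < dyadic n l \<longleftrightarrow> k < l"
  unfolding dyadic_def by (subst strict_mono_less[OF strict_mono_power_Suc]) auto

lemma dyadic_Suc: "k > 0 \<Longrightarrow> dyadic (Suc n) (2 * k) = dyadic n k"
proof (induction k rule: nat_induct_non_zero)
  case 1
  have "dyadic (Suc n) (1 + 1) = dyadic n 1"
    by (subst dyadic_add[symmetric]) (simp_all add: dyadic_def dyadic_root_Suc)
  then show ?case by (simp only: one_add_one mult_1_right)
next
  case (Suc k)
  have "dyadic (Suc n) (1 + 1) = dyadic n 1"
    by (subst dyadic_add[symmetric]) (simp_all add: dyadic_def dyadic_root_Suc)
  moreover have "dyadic (Suc n) (2 * k) \<odot> dyadic (Suc n) (1 + 1) = dyadic (Suc n) (2 * k + (1 + 1))"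
    using Suc by (intro dyadic_add) auto
  moreover have "dyadic n k \<odot> dyadic n 1 = dyadic n (k + 1)"
    using Suc by (intro dyadic_add) auto
  ultimately have "dyadic (Suc n) (2 * k + (1 + 1)) = dyadic n (k + 1)"
    using Suc.IH by metis
  then show ?case by simp
qed

lemma dyadic_shift: "k > 0 \<Longrightarrow> dyadic (n + m) (2 ^ m * k) = dyadic n k"
  by (induction m) (auto simp: dyadic_Suc mult.assoc)

text \<open>Both elements are moved to the common level \<open>m + n\<close>, where only the
  multipliers are compared.\<close>

lemma dyadic_le_iff:
  assumes "k > 0" "l > 0"
  shows "dyadic n k \<le> dyadic m l \<longleftrightarrow> real k / 2 ^ n \<le> real l / 2 ^ m"
proof -
  have "dyadic m l < dyadic n k \<longleftrightarrow> dyadic (m + n) (2 ^ n * l) < dyadic (n + m) (2 ^ m * k)"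
    using assms by (simp add: dyadic_shift)
  also have "\<dots> \<longleftrightarrow> 2 ^ n * l < 2 ^ m * k"
    using assms by (simp add: dyadic_less_iff add.commute)
  also have "\<dots> \<longleftrightarrow> real (2 ^ n * l) < real (2 ^ m * k)"
    by (rule of_nat_less_iff[symmetric])
  also have "\<dots> \<longleftrightarrow> real l / 2 ^ m < real k / 2 ^ n"
    by (simp add: field_simps)
  finally show ?thesis by linarith
qed

section \<open>Hoelder's map: magnitude as a cut in the dyadic values\<close>

definition magnitude :: "real \<Rightarrow> real" where
  "magnitude x = Sup {real k / 2 ^ n | n k. k > 0 \<and> dyadic n k \<le> x}"

lemma dyadic_bracket:
  assumes x: "x \<in> I" and n: "dyadic_root n \<le> x"
  shows "\<exists>k>0. dyadic n k \<le> x \<and> x < dyadic n (Suc k)"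
proof -
  let ?Q = "\<lambda>j. x < power_Suc (dyadic_root n) j"
  have ex: "\<exists>j. ?Q j" using archimedean[OF dyadic_root_in x] .
  \<comment> \<open>\<open>power_Suc\<close> at index \<open>k\<close> is
    \<open>dyadic n (Suc k)\<close>, so the least index that exceeds \<open>x\<close> is itself the
    multiplier sought.\<close>
  define k where "k = (LEAST j. ?Q j)"
  have 1: "?Q k" unfolding k_def using ex by (rule LeastI_ex)
  with n have k: "k > 0" by (cases k) auto
  then have "\<not> ?Q (k - 1)" unfolding k_def by (intro not_less_Least) auto
  with 1 k show ?thesis by (intro exI[of _ k]) (auto simp: dyadic_def)
qed

text \<open>Two dyadic elements with \<open>x\<close> between them have their values in the same
  order, so each dyadic upper bound of \<open>x\<close> bounds the set defining
  \<open>magnitude\<close>. A bracket of \<open>x\<close> shows that this set is nonempty and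
  bounded, so that \<open>Sup\<close> is a genuine supremum.\<close>

lemma
  assumes x: "x \<in> I" and k: "k > 0"
  shows magnitude_ge: "dyadic n k \<le> x \<Longrightarrow> real k / 2 ^ n \<le> magnitude x"
    and magnitude_le: "x \<le> dyadic n k \<Longrightarrow> magnitude x \<le> real k / 2 ^ n"
proof -
  let ?S = "{real k / 2 ^ n | n k. k > 0 \<and> dyadic n k \<le> x}"
  have ub: "s \<le> real l / 2 ^ m" if "x \<le> dyadic m l" "l > 0" "s \<in> ?S" for s l m
    using that by (auto simp: dyadic_le_iff[symmetric])
  obtain n0 where n0: "dyadic_root n0 < x" using dyadic_root_small x by blast
  then obtain k0 where k0: "k0 > 0" "dyadic n0 k0 \<le> x" "x < dyadic n0 (Suc k0)"
    using dyadic_bracket[OF x, of n0] by auto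
  then have ne: "?S \<noteq> {}" by blast
  have bdd: "bdd_above ?S"
    by (rule bdd_aboveI[of _ "real (Suc k0) / 2 ^ n0"]) (use ub[of n0 "Suc k0"] k0 in auto)
  show "real k / 2 ^ n \<le> magnitude x" if "dyadic n k \<le> x"
    unfolding magnitude_def by (rule cSup_upper[OF _ bdd]) (use that k in blast)
  show "magnitude x \<le> real k / 2 ^ n" if "x \<le> dyadic n k"
    unfolding magnitude_def by (rule cSup_least[OF ne]) (use ub[OF that k] in blast)
qed

lemma magnitude_pos:
  assumes "x \<in> I"
  shows "magnitude x > 0"
proof -
  obtain n where "dyadic n 1 < x" using dyadic_root_small[OF assms] by (auto simp: dyadic_def)
  then have "real 1 / 2 ^ n \<le> magnitude x" by (intro magnitude_ge[OF assms]) auto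
  then show ?thesis by (rule less_le_trans[rotated]) simp
qed

lemma eventually_dyadic_root_le:
  assumes "x \<in> I"
  shows "\<forall>\<^sub>F n in sequentially. dyadic_root n \<le> x"
proof -
  obtain n0 where "dyadic_root n0 < x" using dyadic_root_small assms by blast
  then have "\<forall>n\<ge>n0. dyadic_root n \<le> x" using decseq_dyadic_root by (force simp: decseq_def)
  then show ?thesis unfolding eventually_sequentially by blast
qed

lemma magnitude_mono:
  assumes "x \<in> I" "y \<in> I" "x \<le> y"
  shows "magnitude x \<le> magnitude y"
proof (rule field_le_epsilon)
  fix e :: real assume "e > 0"
  have "(\<lambda>n. (1/2) ^ n :: real) \<longlonglongrightarrow> 0" by (rule LIMSEQ_realpow_zero) auto
  then have "\<forall>\<^sub>F n in sequentially. (1/2) ^ n < e" using \<open>e > 0\<close> by (rule order_tendstoD)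
  then have "\<forall>\<^sub>F n in sequentially. (1/2) ^ n < e \<and> dyadic_root n \<le> x"
    using eventually_dyadic_root_le[OF assms(1)] by (rule eventually_conj)
  then obtain n where n: "(1/2) ^ n < e" "dyadic_root n \<le> x"
    by (auto simp: eventually_sequentially)
  then obtain k where k: "k > 0" "dyadic n k \<le> x" "x < dyadic n (Suc k)"
    using dyadic_bracket assms(1) by blast
  have "magnitude x \<le> real (Suc k) / 2 ^ n" using magnitude_le[of x "Suc k" n] assms k by auto
  also have "\<dots> = real k / 2 ^ n + (1/2) ^ n" by (simp add: field_simps)
  also have "\<dots> \<le> magnitude y + e" using magnitude_ge[of y k n] assms k n by auto
  finally show "magnitude x \<le> magnitude y + e" .
qed

text \<open>Brackets of \<open>x\<close> and \<open>y\<close> at level \<open>n\<close> multiply to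
  a bracket of \<open>x \<odot> y\<close> of width \<open>2 / 2 ^ n\<close>. Both sides of the
  equation lie in it, for all large \<open>n\<close>.\<close>

lemma magnitude_mul:
  assumes x: "x \<in> I" and y: "y \<in> I"
  shows "magnitude (x \<odot> y) = magnitude x + magnitude y"
proof -
  have "\<forall>\<^sub>F n in sequentially. \<bar>magnitude (x \<odot> y) - (magnitude x + magnitude y)\<bar> \<le> 2 * (1/2) ^ n"
    using eventually_dyadic_root_le[OF x] eventually_dyadic_root_le[OF y]
  proof eventually_elim
    case (elim n)
    obtain k where k: "k > 0" "dyadic n k \<le> x" "x < dyadic n (Suc k)"
      using dyadic_bracket elim x by blast
    obtain l where l: "l > 0" "dyadic n l \<le> y" "y < dyadic n (Suc l)"
      using dyadic_bracket elim y by blast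
    have "dyadic n k \<odot> dyadic n l \<le> x \<odot> y" using x y k l by (intro mul_le_mono) auto
    then have "dyadic n (k + l) \<le> x \<odot> y" using k l by (simp add: dyadic_add)
    then have 1: "real (k + l) / 2 ^ n \<le> magnitude (x \<odot> y)"
      using k x y by (intro magnitude_ge) (auto intro: closed)
    have "x \<odot> y \<le> dyadic n (Suc k) \<odot> dyadic n (Suc l)"
      using x y k l by (intro mul_le_mono) auto
    then have "x \<odot> y \<le> dyadic n (k + l + 2)" by (simp add: dyadic_add)
    then have 2: "magnitude (x \<odot> y) \<le> real (k + l + 2) / 2 ^ n"
      using k x y by (intro magnitude_le) (auto intro: closed)
    have 3: "real k / 2 ^ n \<le> magnitude x" "magnitude x \<le> real (Suc k) / 2 ^ n"
      using magnitude_ge[OF x k(1,2)] magnitude_le[of x "Suc k" n] x k by auto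
    have 4: "real l / 2 ^ n \<le> magnitude y" "magnitude y \<le> real (Suc l) / 2 ^ n"
      using magnitude_ge[OF y l(1,2)] magnitude_le[of y "Suc l" n] y l by auto
    show ?case using 1 2 3 4 by (simp add: field_simps abs_le_iff)
  qed
  moreover have "(\<lambda>n. 2 * (1/2) ^ n :: real) \<longlonglongrightarrow> 2 * 0"
    by (intro tendsto_mult LIMSEQ_realpow_zero tendsto_const) auto
  ultimately have "\<bar>magnitude (x \<odot> y) - (magnitude x + magnitude y)\<bar> \<le> 2 * 0"
    by (intro tendsto_lowerbound[where F = sequentially]) auto
  then show ?thesis by simp
qed

text \<open>The preimage of \<open>c\<close> is the supremum of the dyadic elements of value at most
  \<open>c\<close>. At every fine level it is bracketed by the dyadic elements whose values bracket
  \<open>c\<close>.\<close>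

lemma magnitude_surj:
  assumes c: "c > 0"
  shows "\<exists>x\<in>I. magnitude x = c"
proof -
  define T where "T = {dyadic n k | n k. k > 0 \<and> real k / 2 ^ n \<le> c}"
  have floor_in: "\<forall>\<^sub>F n in sequentially. (1/2) ^ n < c"
    by (rule order_tendstoD[OF LIMSEQ_realpow_zero]) (use c in auto)
  have bracket: "\<exists>k>0. real k / 2 ^ n \<le> c \<and> c < real (Suc k) / 2 ^ n" if "(1/2) ^ n < c" for n
  proof -
    have "1 < c * 2 ^ n" using that by (simp add: field_simps)
    moreover define k where "k = nat \<lfloor>c * 2 ^ n\<rfloor>"
    ultimately have "k > 0" "real k \<le> c * 2 ^ n" "c * 2 ^ n < real (Suc k)" by (auto; linarith)+
    then show ?thesis by (intro exI[of _ k]) (auto simp: field_simps)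
  qed
  have ub: "t \<le> dyadic n k" if "t \<in> T" "k > 0" "c \<le> real k / 2 ^ n" for t n k
    using that by (auto simp: T_def dyadic_le_iff)
  obtain n0 k0 where k0: "k0 > 0" "real k0 / 2 ^ n0 \<le> c" "c < real (Suc k0) / 2 ^ n0"
    using floor_in bracket unfolding eventually_sequentially by blast
  have T0: "dyadic n0 k0 \<in> T" using k0 by (auto simp: T_def)
  have bdd: "bdd_above T"
    by (rule bdd_aboveI[of _ "dyadic n0 (Suc k0)"]) (use k0 in \<open>auto intro!: ub\<close>)
  define x where "x = Sup T"
  have ge: "t \<le> x" if "t \<in> T" for t unfolding x_def using that bdd by (rule cSup_upper)
  have le: "x \<le> dyadic n k" if "k > 0" "c \<le> real k / 2 ^ n" for n k
    unfolding x_def using T0 that by (intro cSup_least) (auto intro: ub)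
  have x: "x \<in> I"
    by (rule between_in[OF _ _ ge[OF T0] le[of "Suc k0" n0]]) (use k0 in auto)
  have "\<forall>\<^sub>F n in sequentially. \<bar>magnitude x - c\<bar> \<le> (1/2) ^ n"
    using floor_in
  proof eventually_elim
    case (elim n)
    then obtain k where k: "k > 0" "real k / 2 ^ n \<le> c" "c < real (Suc k) / 2 ^ n"
      using bracket by blast
    then have "real k / 2 ^ n \<le> magnitude x" by (intro magnitude_ge x ge) (auto simp: T_def)
    moreover have "magnitude x \<le> real (Suc k) / 2 ^ n" using k by (intro magnitude_le x le) auto
    ultimately show ?case using k by (simp add: field_simps abs_le_iff)
  qed
  then have "\<bar>magnitude x - c\<bar> \<le> 0"
    by (intro tendsto_lowerbound[OF LIMSEQ_realpow_zero[of "1/2"]]) auto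
  with x show ?thesis by auto
qed

text \<open>A fibre of \<open>magnitude\<close> with two points \<open>x < y\<close> would have the translates \<open>(x \<odot> z, y \<odot> z)\<close>, and
  these would be uncountably many disjoint nonempty open intervals.\<close>

lemma magnitude_strict_mono:
  assumes x: "x \<in> I" and y: "y \<in> I" and less: "x < y"
  shows "magnitude x < magnitude y"
proof (rule ccontr)
  assume "\<not> ?thesis"
  then have eq: "magnitude y = magnitude x" using magnitude_mono[OF x y] less by simp
  have "\<forall>d\<in>{0<..}. \<exists>z. z \<in> I \<and> magnitude z = d" using magnitude_surj by auto
  then obtain z where z: "\<And>d. d > 0 \<Longrightarrow> z d \<in> I \<and> magnitude (z d) = d"
    by (metis greaterThan_iff)
  \<comment> \<open>One rational is picked in each translated interval; the order of the intervals
    makes the choice injective.\<close>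
  have "\<forall>d. d > 0 \<longrightarrow> (\<exists>q\<in>\<rat>. x \<odot> z d < q \<and> q < y \<odot> z d)"
    using x y z less by (auto intro!: Rats_dense_in_real)
  then obtain q where q: "\<And>d. d > 0 \<Longrightarrow> q d \<in> \<rat> \<and> x \<odot> z d < q d \<and> q d < y \<odot> z d"
    by metis
  have q_less: "q d < q d'" if "0 < d" "d < d'" for d d'
  proof -
    \<comment> \<open>As \<open>x\<close> and \<open>y\<close> have equal magnitude, the translate
      by \<open>z d\<close> lies wholly below the one by \<open>z d'\<close>.\<close>
    have "magnitude (y \<odot> z d) < magnitude (x \<odot> z d')" using that z[of d] z[of d'] x y eq by (simp add: magnitude_mul)
    then have "y \<odot> z d < x \<odot> z d'"
      using magnitude_mono[of "x \<odot> z d'" "y \<odot> z d"] z[of d] z[of d'] that x y closed by force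
    then show ?thesis using q[of d] q[of d'] that by linarith
  qed
  have "inj_on q {0<..}"
    by (rule linorder_inj_onI) (use q_less in force)+
  moreover have "q ` {0<..} \<subseteq> \<rat>" using q by auto
  ultimately have "countable {0::real<..}"
    using countable_rat countable_subset countable_image_inj_on by blast
  moreover have "uncountable {0::real<..<1}" by (simp add: uncountable_open_interval)
  ultimately show False using countable_subset[of "{0::real<..<1}" "{0<..}"] by force
qed

lemma bij_betw_magnitude: "bij_betw magnitude I {0<..}"
  unfolding bij_betw_def
proof
  show "inj_on magnitude I" by (rule linorder_inj_onI) (use magnitude_strict_mono in force)+
  show "magnitude ` I = {0<..}" using magnitude_pos magnitude_surj by auto
qed

end

section \<open>Positive and negative elements, and extension of the map to \<open>I\<close>\<close>

context rooted_interval_semigroup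
begin

definition pos :: "real set" where "pos = {x \<in> I. x < x \<odot> x}"

definition neg :: "real set" where "neg = {x \<in> I. x \<odot> x < x}"

lemma pos_in: "x \<in> pos \<Longrightarrow> x \<in> I"
  by (simp add: pos_def)

text \<open>Since \<open>x\<close> moves \<open>y\<close> up,
  \<open>y < x \<odot> y \<le> y \<odot> y\<close>.\<close>

lemma pos_upward: "x \<in> pos \<Longrightarrow> y \<in> I \<Longrightarrow> x \<le> y \<Longrightarrow> y \<in> pos"
  using less_mul_left_iff[of x y] mul_le_mono[of x y y y] by (auto simp: pos_def)

lemma pos_mul: "x \<in> pos \<Longrightarrow> y \<in> pos \<Longrightarrow> x \<odot> y \<in> pos"
  using less_mul_right_iff[of x y] by (intro pos_upward[of x "x \<odot> y"]) (auto simp: pos_def closed)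

lemma pos_sqroot:
  assumes "x \<in> pos"
  shows "sqroot x \<in> pos"
proof -
  have s: "sqroot x \<in> I" "sqroot x \<odot> sqroot x = x" using assms sqroot by (auto simp: pos_def)
  then have "sqroot x < x"
    using assms square_less_iff[of "sqroot x" x] by (auto simp: pos_def)
  with s show ?thesis by (simp add: pos_def)
qed

lemma positive_interval_semigroup_pos:
  assumes "pos \<noteq> {}"
  shows "positive_interval_semigroup pos (\<odot>)"
proof unfold_locales
  show "is_interval pos"
    unfolding is_interval_1 by (meson between_in pos_in pos_upward)
  show "admits_square_root pos (\<odot>) x" if "x \<in> pos" for x
    using pos_sqroot[OF that] sqroot_square[OF pos_in[OF that]] by (auto simp: admits_square_root_def)
  show "x < x \<odot> x" if "x \<in> pos" for x
    using that by (simp add: pos_def)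
qed (use assms in \<open>auto simp: pos_mul pos_in assoc less_imp_le dest!: order.not_eq_order_implies_strict
      intro: reflp_onI transp_onI antisymp_onI totalp_onI\<close>)

text \<open>The logarithm \<open>f\<close> of the positive part extends by \<open>F y = f (p \<odot> y) - f p\<close>, where \<open>p\<close> is
  so large that \<open>p \<odot> y\<close> is positive.\<close>

lemma additive_embedding:
  assumes ne: "pos \<noteq> {}" and shift: "\<And>y. y \<in> I \<Longrightarrow> \<exists>p\<in>pos. p \<odot> y \<in> pos"
  obtains F :: "real \<Rightarrow> real" where "strict_mono_on I F"
    and "\<And>x y. x \<in> I \<Longrightarrow> y \<in> I \<Longrightarrow> F (x \<odot> y) = F x + F y"
    and "F ` I \<in> {UNIV, {0..}, {0<..}}"
proof -
  interpret P: positive_interval_semigroup pos "(\<odot>)"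
    using positive_interval_semigroup_pos[OF ne] .
  define f where "f = P.magnitude"
  have f_mul: "f (x \<odot> y) = f x + f y" if "x \<in> pos" "y \<in> pos" for x y
    using that unfolding f_def by (rule P.magnitude_mul)
  have f_less: "f x < f y" if "x \<in> pos" "y \<in> pos" "x < y" for x y
    using that unfolding f_def by (rule P.magnitude_strict_mono)
  have f_bij: "bij_betw f pos {0<..}" unfolding f_def by (rule P.bij_betw_magnitude)
  \<comment> \<open>Real addition commutes and \<open>f\<close> is injective.\<close>
  have comm: "x \<odot> y = y \<odot> x" if "x \<in> pos" "y \<in> pos" for x y
    by (rule inj_onD[OF bij_betw_imp_inj_on[OF f_bij]]) (use that in \<open>auto simp: f_mul pos_mul\<close>)
  define shifter where "shifter y = (SOME p. p \<in> pos \<and> p \<odot> y \<in> pos)" for y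
  have shifter: "shifter y \<in> pos" "shifter y \<odot> y \<in> pos" if "y \<in> I" for y
    using someI_ex[of "\<lambda>p. p \<in> pos \<and> p \<odot> y \<in> pos"] shift[OF that] by (auto simp: shifter_def)
  define F where "F y = f (shifter y \<odot> y) - f (shifter y)" for y
  \<comment> \<open>The value is independent of the shifting element: apply \<open>f\<close> to
    \<open>shifter y \<odot> (p \<odot> y) = p \<odot> (shifter y \<odot> y)\<close>, which holds by
    commutativity in \<open>pos\<close>.\<close>
  have F_eq: "F y = f (p \<odot> y) - f p" if y: "y \<in> I" and p: "p \<in> pos" "p \<odot> y \<in> pos" for y p
  proof -
    note q = shifter[OF y]
    have "shifter y \<odot> (p \<odot> y) = p \<odot> (shifter y \<odot> y)"
      using comm[OF p(1) q(1)] p q y by (simp add: assoc[symmetric] pos_in)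
    then show ?thesis using f_mul[OF q(1) p(2)] f_mul[OF p(1) q(2)] by (simp add: F_def)
  qed
  have shift2: "\<exists>p\<in>pos. p \<odot> y \<in> pos \<and> p \<odot> z \<in> pos" if y: "y \<in> I" and z: "z \<in> I" for y z
  proof (intro bexI conjI)
    let ?p = "max (shifter y) (shifter z)"
    show p: "?p \<in> pos" using shifter y z by (auto simp: max_def)
    show "?p \<odot> y \<in> pos"
      using shifter[OF y] p y by (intro pos_upward[OF shifter(2)[OF y]] mul_le_mono closed) (auto simp: pos_in)
    show "?p \<odot> z \<in> pos"
      using shifter[OF z] p z by (intro pos_upward[OF shifter(2)[OF z]] mul_le_mono closed) (auto simp: pos_in)
  qed
  \<comment> \<open>Commutativity is known in \<open>pos\<close> only, so shifts from the right are
    compared with shifts from the left through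
    \<open>(p \<odot> y) \<odot> p = p \<odot> (y \<odot> p)\<close>.\<close>
  have right: "y \<odot> p \<in> pos \<and> F y = f (y \<odot> p) - f p"
    if y: "y \<in> I" and p: "p \<in> pos" "p \<odot> y \<in> pos" for y p
  proof
    have pI: "p \<in> I" using p by (simp add: pos_in)
    have ypI: "y \<odot> p \<in> I" using y pI by (rule closed)
    have "p < (p \<odot> y) \<odot> p"
      using less_mul_left_iff[of "p \<odot> y" p] p(2) pI unfolding pos_def by blast
    then have "p < p \<odot> (y \<odot> p)" by (simp only: assoc pI y)
    then show yp: "y \<odot> p \<in> pos"
      using less_mul_right_iff[OF pI ypI] ypI unfolding pos_def by blast
    show "F y = f (y \<odot> p) - f p"
      using f_mul[OF p(2,1)] f_mul[OF p(1) yp] F_eq[OF y p] pI y by (simp add: assoc)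
  qed
  have F_mul: "F (y \<odot> z) = F y + F z" if y: "y \<in> I" and z: "z \<in> I" for y z
  proof -
    have yz: "y \<odot> z \<in> I" using y z by (rule closed)
    \<comment> \<open>\<open>y\<close> is shifted from the left and \<open>z\<close> from the right,
      so that the two factors stay adjacent.\<close>
    obtain p where p: "p \<in> pos" "p \<odot> y \<in> pos" "p \<odot> (y \<odot> z) \<in> pos"
      using shift2[OF y yz] by blast
    define q where "q = shifter z"
    have q: "q \<in> pos" "z \<odot> q \<in> pos" "F z = f (z \<odot> q) - f q"
      using right[OF z] shifter[OF z] by (auto simp: q_def)
    have "(p \<odot> (y \<odot> z)) \<odot> q = (p \<odot> y) \<odot> (z \<odot> q)"
      using p q y z by (simp add: assoc closed pos_in)
    then show ?thesis
      using f_mul[OF p(3) q(1)] f_mul[OF p(2) q(2)] q(3) F_eq[OF y p(1,2)] F_eq[OF yz p(1,3)]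
      by simp
  qed
  have F_mono: "strict_mono_on I F"
  proof (rule strict_mono_onI)
    fix y z assume yz: "y \<in> I" "z \<in> I" "y < z"
    then obtain p where "p \<in> pos" "p \<odot> y \<in> pos" "p \<odot> z \<in> pos" using shift2 by blast
    then show "F y < F z" using yz F_eq f_less[of "p \<odot> y" "p \<odot> z"] by (simp add: pos_in)
  qed
  have F_pos: "F y = f y" if "y \<in> pos" for y
    using F_eq[of y y] that by (simp add: f_mul pos_mul pos_in)
  have greater_0: "r \<in> F ` I" if r: "r > 0" for r
  proof -
    have "r \<in> f ` pos" using f_bij r by (simp add: bij_betw_def)
    then obtain p where "p \<in> pos" "f p = r" by blast
    then show ?thesis using F_pos pos_in by (intro image_eqI[of _ _ p]) auto
  qed
  have add: "r + s \<in> F ` I" if "r \<in> F ` I" "s \<in> F ` I" for r s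
    using that F_mul closed by (metis (no_types, lifting) image_iff)
  \<comment> \<open>The image contains all positive reals and is closed under addition. With a
    negative value come arbitrarily negative multiples, and adding positive reals to these reaches
    everything; otherwise only the membership of 0 is open.\<close>
  have range: "F ` I \<in> {UNIV, {0..}, {0<..}}"
  proof (cases "\<exists>s\<in>F ` I. s < 0")
    case True
    then obtain s where s: "s \<in> F ` I" "s < 0" by blast
    have multiples: "real (Suc n) * s \<in> F ` I" for n
    proof (induction n)
      case (Suc n)
      have "real (Suc (Suc n)) * s = s + real (Suc n) * s" by (simp add: algebra_simps)
      then show ?case using add[OF s(1) Suc] by simp
    qed (use s in simp)
    have "r \<in> F ` I" for r
    proof -
      obtain n where "- r < real n * (- s)" using s reals_Archimedean3[of "- s"] by (meson neg_0_less_iff_less)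
      then have "r - real (Suc n) * s > 0" using s by (simp add: algebra_simps)
      then have "real (Suc n) * s + (r - real (Suc n) * s) \<in> F ` I"
        by (intro add multiples greater_0)
      then show ?thesis by simp
    qed
    then show ?thesis by auto
  next
    case False
    show ?thesis
    proof (cases "0 \<in> F ` I")
      case True
      then have "F ` I = {0..}" using False greater_0 by (force simp: le_less not_less)
      then show ?thesis by simp
    next
      case not_0: False
      then have "F ` I = {0<..}" using False greater_0 by (force simp: le_less not_less)
      then show ?thesis by simp
    qed
  qed
  show ?thesis by (rule that[OF F_mono F_mul range])
qed

section \<open>Reversal of the order and the choice of a side\<close>

lemma dual: "rooted_interval_semigroup (uminus ` I) (\<lambda>x y. - (- x \<odot> - y))"
proof unfold_locales
  show "is_interval (uminus ` I)" using interval by simp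
  show "admits_square_root (uminus ` I) (\<lambda>x y. - (- x \<odot> - y)) x" if "x \<in> uminus ` I" for x
    using that roots by (force simp: admits_square_root_def)
qed (use nonempty in \<open>auto simp: closed assoc less_imp_le dest!: order.not_eq_order_implies_strict\<close>)

text \<open>If both alternatives failed, there would be a negative \<open>y\<close> that no positive
  element shifts into \<open>pos\<close> and a positive \<open>z\<close> that behaves dually. Then
  \<open>y \<odot> z\<close> is idempotent, hence so is \<open>z \<odot> y\<close>, and
  \<open>(z \<odot> z) \<odot> y = z\<close> shows that \<open>z \<odot> z\<close> does shift
  \<open>y\<close>.\<close>

lemma shift_pos_or_neg:
  assumes "pos \<noteq> {} \<or> neg \<noteq> {}"
  shows "pos \<noteq> {} \<and> (\<forall>y\<in>I. \<exists>p\<in>pos. p \<odot> y \<in> pos) \<or> neg \<noteq> {} \<and> (\<forall>z\<in>I. \<exists>x\<in>neg. x \<odot> z \<in> neg)"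
proof (rule ccontr)
  assume contr: "\<not> ?thesis"
  have posI: "x \<in> I \<Longrightarrow> x < x \<odot> x \<Longrightarrow> x \<in> pos" for x by (simp add: pos_def)
  have trichotomy: "x \<in> pos \<or> x \<in> neg \<or> x \<odot> x = x" if "x \<in> I" for x
    using that by (auto simp: pos_def neg_def)
  have neg_in: "x \<in> I" if "x \<in> neg" for x using that by (simp add: neg_def)
  have neg_square: "x \<odot> x \<in> neg" if "x \<in> neg" for x
    using that mul_less_mono[of "x \<odot> x" x "x \<odot> x" x] by (simp add: neg_def closed)
  have idem_mul: "x \<odot> y = x" if "x \<in> I" "y \<in> I" "y \<odot> y = y" for x y
    using that mul_right_eq_iff by blast
  \<comment> \<open>A positive \<open>y\<close> can be shifted by any positive \<open>p\<close>, and
    an idempotent \<open>y\<close> leaves \<open>p\<close> unchanged, so only a negative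
    \<open>y\<close> resists.\<close>
  have neg: "y \<in> neg" if "y \<in> I" "pos \<noteq> {}" "\<And>p. p \<in> pos \<Longrightarrow> p \<odot> y \<notin> pos" for y
    using trichotomy[of y] that pos_mul[of _ y] idem_mul[of _ y] by (metis all_not_in_conv pos_in)
  have pos: "z \<in> pos" if "z \<in> I" "neg \<noteq> {}" "\<And>x. x \<in> neg \<Longrightarrow> x \<odot> z \<notin> neg" for z
    using trichotomy[of z] that neg_square[of z] idem_mul[of _ z] by (metis all_not_in_conv neg_in)
  have "pos \<noteq> {} \<and> neg \<noteq> {}"
    using assms contr neg pos by (metis all_not_in_conv)
  then obtain y z where y: "y \<in> neg" "\<And>p. p \<in> pos \<Longrightarrow> p \<odot> y \<notin> pos"
    and z: "z \<in> pos" "\<And>x. x \<in> neg \<Longrightarrow> x \<odot> z \<notin> neg"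
    using contr neg pos by metis
  have I: "y \<in> I" "z \<in> I" "y \<odot> z \<in> I" "z \<odot> y \<in> I" using y z closed by (auto simp: pos_in neg_in)
  \<comment> \<open>Otherwise \<open>y < y \<odot> (z \<odot> y)\<close>, so
    \<open>z \<odot> y\<close> is positive too, although \<open>z\<close> must not shift
    \<open>y\<close>.\<close>
  have "y \<odot> z \<notin> pos"
  proof
    assume "y \<odot> z \<in> pos"
    then have "y < (y \<odot> z) \<odot> y" using I less_mul_left_iff[of "y \<odot> z" y] unfolding pos_def by blast
    then have "z \<odot> y \<in> pos" using I less_mul_right_iff[of y "z \<odot> y"] posI by (simp only: assoc)
    then show False using y z by blast
  qed
  then have "(y \<odot> z) \<odot> (y \<odot> z) = y \<odot> z" using trichotomy[of "y \<odot> z"] y z I by blast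
  then have "(y \<odot> z) \<odot> y = y" using I mul_left_eq_iff by blast
  then have "(z \<odot> y) \<odot> (z \<odot> y) = z \<odot> y" using I mul_right_eq_iff[of y "z \<odot> y"] by (simp only: assoc)
  then have "z \<odot> (z \<odot> y) = z" using I mul_right_eq_iff by blast
  then have "(z \<odot> z) \<odot> y \<in> pos" using I z by (simp only: assoc)
  then show False using y z pos_mul by blast
qed

end

section \<open>Transfer to semigroups of reals and the final case distinction\<close>

lemma slos_isomorphic_add:
  fixes F :: "'a \<Rightarrow> real"
  assumes S: "strictly_linearly_ordered_semigroup I le mul"
    and mono: "monotone_on I le (\<le>) F \<or> monotone_on I le (\<lambda>u v. v \<le> u) F"
    and inj: "inj_on F I"
    and hom: "\<And>x y. x \<in> I \<Longrightarrow> y \<in> I \<Longrightarrow> F (mul x y) = F x + F y"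
  shows "slos_isomorphic I le mul (F ` I) (\<le>) (+)"
proof -
  interpret S: strictly_linearly_ordered_semigroup I le mul by (rule S)
  have add: "r + s \<in> F ` I" if "r \<in> F ` I" "s \<in> F ` I" for r s
    using that hom S.closed by (metis (no_types, lifting) image_iff)
  have "strictly_linearly_ordered_semigroup (F ` I) (\<le>) (+)"
    by unfold_locales (use S.nonempty add in \<open>auto intro!: reflp_onI transp_onI antisymp_onI totalp_onI\<close>)
  then show ?thesis
    using S mono inj hom unfolding slos_isomorphic_def slos_isomorphism_def
    by (auto intro!: exI[of _ F] inj_on_imp_bij_betw)
qed

theorem corollary1p3:
  fixes I :: "real set" and mul :: "real \<Rightarrow> real \<Rightarrow> real"
  assumes "is_interval I" and "I \<noteq> {}"
    and "strictly_linearly_ordered_semigroup I (\<le>) mul"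
    and "\<And>x. x \<in> I \<Longrightarrow> admits_square_root I mul x"
  shows "\<exists>J \<in> {UNIV, {0..}, {0<..}, {0}} :: real set set. slos_isomorphic I (\<le>) mul J (\<le>) (+)"
proof -
  interpret R: rooted_interval_semigroup I mul
    using assms by (simp add: rooted_interval_semigroup_def rooted_interval_semigroup_axioms_def)
  let ?mul = "\<lambda>x y. - mul (- x) (- y)"
  interpret D: rooted_interval_semigroup "uminus ` I" ?mul
    by (rule R.dual)
  \<comment> \<open>Reflection turns the second alternative into the first one for the reflected
    semigroup.\<close>
  have D_pos: "D.pos = uminus ` R.neg"
    by (auto simp: D.pos_def R.neg_def image_iff)
  consider
    (pos) "R.pos \<noteq> {}" "\<forall>y\<in>I. \<exists>p\<in>R.pos. mul p y \<in> R.pos"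
  | (neg) "R.neg \<noteq> {}" "\<forall>z\<in>I. \<exists>x\<in>R.neg. mul x z \<in> R.neg"
  | (trivial) "R.pos = {}" "R.neg = {}"
    using R.shift_pos_or_neg by blast
  then show ?thesis
  proof cases
    case pos
    then obtain F :: "real \<Rightarrow> real" where F: "strict_mono_on I F" "F ` I \<in> {UNIV, {0..}, {0<..}}"
      and hom: "\<And>x y. x \<in> I \<Longrightarrow> y \<in> I \<Longrightarrow> F (mul x y) = F x + F y"
      by (metis R.additive_embedding)
    have "slos_isomorphic I (\<le>) mul (F ` I) (\<le>) (+)"
      using strict_mono_on_imp_mono_on[OF F(1)] strict_mono_on_imp_inj_on[OF F(1)] hom
      by (intro slos_isomorphic_add[OF assms(3)]) auto
    with F(2) show ?thesis by auto
  next
    case neg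
    have "\<exists>p\<in>D.pos. ?mul p y \<in> D.pos" if "y \<in> uminus ` I" for y
      using neg(2) that unfolding D_pos by force
    moreover have "D.pos \<noteq> {}" using neg(1) D_pos by simp
    ultimately obtain G :: "real \<Rightarrow> real" where G: "strict_mono_on (uminus ` I) G" "G ` uminus ` I \<in> {UNIV, {0..}, {0<..}}"
      and hom: "\<And>x y. x \<in> uminus ` I \<Longrightarrow> y \<in> uminus ` I \<Longrightarrow> G (?mul x y) = G x + G y"
      using D.additive_embedding by metis
    \<comment> \<open>Composition with negation makes this map order-reversing on
      \<open>I\<close>.\<close>
    define F where "F x = G (- x)" for x
    have "F (mul x y) = F x + F y" if "x \<in> I" "y \<in> I" for x y
      using hom[of "- x" "- y"] that by (simp add: F_def)
    moreover have "monotone_on I (\<le>) (\<lambda>u v. v \<le> u) F"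
      using strict_mono_on_imp_mono_on[OF G(1)] by (auto simp: F_def monotone_on_def)
    moreover have "inj_on F I"
      using strict_mono_on_imp_inj_on[OF G(1)] by (auto simp: F_def inj_on_def)
    ultimately have "slos_isomorphic I (\<le>) mul (F ` I) (\<le>) (+)"
      by (intro slos_isomorphic_add[OF assms(3)]) auto
    moreover have "F ` I = G ` uminus ` I" by (auto simp: F_def)
    ultimately show ?thesis using G(2) by auto
  next
    case trivial
    then have idem: "mul x x = x" if "x \<in> I" for x
      using that by (metis (mono_tags, lifting) R.neg_def R.pos_def empty_iff linorder_neqE mem_Collect_eq)
    \<comment> \<open>Multiplication by an idempotent fixes every element, so \<open>mul x y\<close>
      equals both \<open>y\<close> and \<open>x\<close>.\<close>
    have "x = y" if "x \<in> I" "y \<in> I" for x y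
      using R.mul_left_eq_iff[OF that] R.mul_right_eq_iff[OF that] idem[OF that(1)] idem[OF that(2)] by simp
    then have inj: "inj_on (\<lambda>_. 0::real) I" by (auto simp: inj_on_def)
    have "slos_isomorphic I (\<le>) mul ((\<lambda>_. 0::real) ` I) (\<le>) (+)"
      by (rule slos_isomorphic_add[OF assms(3) _ inj]) (auto simp: monotone_on_def)
    moreover have "(\<lambda>_. 0::real) ` I = {0}" using assms(2) by auto
    ultimately show ?thesis by auto
  qed
qed

end
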